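(* Let $\mathcal A$ and $\mathcal B$ be labeled combinatorial classes with $\mathcal A=\mathrm{CYC}(\mathcal B)$, and assume $\mathcal A$ is gargantuan. Let $a\in\mathcal A$ be a uniformly random object of size $n$. Then for every positive integer $m$, \[ \mathbb P(a\text{ has }m\ \mathrm{CYC}\text{-irreducible components})\approx\sum_{k\ge0}\Big(\mathfrak b_k^{(m-1)}-\mathfrak b_k^{(m)}\Big)\binom{n}{k}\frac{\mathfrak a_{n-k}}{\mathfrak a_n}. \] In particular, for $m=1$, \[ \mathbb P(a\text{ is }\mathrm{CYC}\text{-irreducible})\approx1-\sum_{k\ge1}\mathfrak b_k\binom{n}{k}\frac{\mathfrak a_{n-k}}{\mathfrak a_n}. \]
   Context: A labeled combinatorial class is a collection of objects, each of finite size $n$ with atoms labeled bijectively by $[n]$, stable under relabeling, with finitely many objects $\mathfrak a_n$ of each size; EGF $A(z)=\sum_n\mathfrak a_nz^n/n!$. For a labeled class $\mathcal B$ with $\mathfrak b_0=0$, $\mathcal B^m$ is the labeled product of $m$ copies (EGF $B(z)^m$); $\mathrm{CYC}_m(\mathcal B)$ is the class of $m$-cycles of $\mathcal B$-objects (labeled $m$-sequences taken up to cyclic rotation), with EGF $B(z)^m/m$, and $\mathrm{CYC}(\mathcal B)=\sum_{m\ge1}\mathrm{CYC}_m(\mathcal B)$, with EGF $\log\frac{1}{1-B(z)}$. If $\mathcal A=\mathrm{CYC}(\mathcal B)$, an object of $\mathcal A$ lying in $\mathrm{CYC}_m(\mathcal B)$ has $m$ $\mathrm{CYC}$-irreducible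 components ($m=1$: $\mathrm{CYC}$-irreducible). $\mathfrak b_n^{(m)}$ is the number of objects of size $n$ in $\mathcal B^m$, with $\mathfrak b_0^{(0)}=1$, $\mathfrak b_n^{(0)}=0$ for $n>0$. Random objects of size $n$ are uniform. A sequence $(a_n)$ is gargantuan if $a_{n-1}/a_n\to0$ and for every positive integer $r$, $\sum_{k=r}^{n-r}|a_ka_{n-k}|=O(a_{n-r})$; a labeled class is gargantuan if $(\mathfrak a_n/n!)$ is gargantuan. Notation: $x_n\approx\sum_{k\ge m}c_kf_k(n)$ means that for every $r\ge m$, $x_n=\sum_{k=m}^r c_kf_k(n)+O(f_{r+1}(n))$, and $f_{k+1}(n)=o(f_k(n))$ for every $k\ge m$ (the $c_k$ may be zero). *)

theory Defs
  imports "HOL-Probability.Probability" "HOL-Library.Landau_Symbols"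
    "HOL-Combinatorics.Permutations"
begin

(* objs A n is the set of objects of size n, whose atoms are labeled by {1..n};
   relabel A s a renames, for a permutation s of {1..n}, every label i of a to s i. *)
record 'a lclass =
  objs :: "nat \<Rightarrow> 'a set"
  relabel :: "(nat \<Rightarrow> nat) \<Rightarrow> 'a \<Rightarrow> 'a"

locale labeled_class =
  fixes A :: "'a lclass"
  assumes finite_objs: "finite (objs A n)"
    and size_unique: "a \<in> objs A n \<Longrightarrow> a \<in> objs A n' \<Longrightarrow> n = n'"
    and relabel_closed: "a \<in> objs A n \<Longrightarrow> s permutes {1..n} \<Longrightarrow> relabel A s a \<in> objs A n"
    and relabel_id: "a \<in> objs A n \<Longrightarrow> relabel A id a = a"
    and relabel_comp: "a \<in> objs A n \<Longrightarrow> s permutes {1..n} \<Longrightarrow> t permutes {1..n} \<Longrightarrow>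
      relabel A (s \<circ> t) a = relabel A s (relabel A t a)"

definition num_objs :: "'a lclass \<Rightarrow> nat \<Rightarrow> nat" where
  "num_objs A n = card (objs A n)"

(* Equality of combinatorial classes is, as usual, equality up to a bijection that
   preserves sizes and commutes with relabeling. *)
definition class_iso :: "('a \<Rightarrow> 'b) \<Rightarrow> 'a lclass \<Rightarrow> 'b lclass \<Rightarrow> bool" where
  "class_iso \<phi> A B \<longleftrightarrow>
     (\<forall>n. bij_betw \<phi> (objs A n) (objs B n)) \<and>
     (\<forall>n. \<forall>a\<in>objs A n. \<forall>s. s permutes {1..n} \<longrightarrow>
        \<phi> (relabel A s a) = relabel B s (\<phi> a))"

definition label_rank :: "nat set \<Rightarrow> nat \<Rightarrow> nat" where
  "label_rank S x = card {y \<in> S. y \<le> x}"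

(* A B-object whose atoms carry the labels of a finite set S is encoded as the pair (S, b),
   where b is its reduction: the label x in S is replaced by label_rank S x in {1..card S}.
   Renaming the labels by s turns S into s ` S and acts on the reduction b by the
   permutation induced s S of {1..card S}. *)
definition induced :: "(nat \<Rightarrow> nat) \<Rightarrow> nat set \<Rightarrow> nat \<Rightarrow> nat" where
  "induced s S i =
     (if i \<in> {1..card S} then label_rank (s ` S) (s (the_inv_into S (label_rank S) i)) else i)"

definition relabel_seq ::
  "'b lclass \<Rightarrow> (nat \<Rightarrow> nat) \<Rightarrow> (nat set \<times> 'b) list \<Rightarrow> (nat set \<times> 'b) list" where
  "relabel_seq B s = map (\<lambda>(S, b). (s ` S, relabel B (induced s S) b))"

(* The labeled product of m copies of B.  For m = 0 its only object is the empty
   sequence, of size 0. *)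
definition labeled_power :: "'b lclass \<Rightarrow> nat \<Rightarrow> (nat set \<times> 'b) list lclass" where
  "labeled_power B m =
     \<lparr> objs = (\<lambda>n. {xs. length xs = m \<and>
          (\<forall>(S, b)\<in>set xs. b \<in> objs B (card S)) \<and>
          (\<forall>i<m. \<forall>j<m. i \<noteq> j \<longrightarrow> fst (xs ! i) \<inter> fst (xs ! j) = {}) \<and>
          (\<Union>(S, b)\<in>set xs. S) = {1..n}}),
       relabel = relabel_seq B \<rparr>"

definition rotation :: "('c list \<times> 'c list) set" where
  "rotation = {(xs, ys). \<exists>k. ys = rotate k xs}"

definition CYC_m :: "nat \<Rightarrow> 'b lclass \<Rightarrow> (nat set \<times> 'b) list set lclass" where
  "CYC_m m B =
     \<lparr> objs = (\<lambda>n. objs (labeled_power B m) n // rotation),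
       relabel = (\<lambda>s c. relabel_seq B s ` c) \<rparr>"

definition CYC :: "'b lclass \<Rightarrow> (nat set \<times> 'b) list set lclass" where
  "CYC B =
     \<lparr> objs = (\<lambda>n. \<Union>m\<in>{1..}. objs (CYC_m m B) n),
       relabel = (\<lambda>s c. relabel_seq B s ` c) \<rparr>"

definition has_components ::
  "'b lclass \<Rightarrow> nat \<Rightarrow> (nat set \<times> 'b) list set \<Rightarrow> bool" where
  "has_components B m c \<longleftrightarrow> (\<exists>n. c \<in> objs (CYC_m m B) n)"

(* The first conjunct says that the quotients in the second one are eventually meaningful;
   it is needed because x / 0 = 0. *)
definition gargantuan :: "(nat \<Rightarrow> real) \<Rightarrow> bool" where
  "gargantuan a \<longleftrightarrow>
     (\<forall>\<^sub>F n in sequentially. a n \<noteq> 0) \<and>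
     (\<lambda>n. a (n - 1) / a n) \<longlonglongrightarrow> 0 \<and>
     (\<forall>r\<ge>1. (\<lambda>n. \<Sum>k=r..n-r. \<bar>a k * a (n - k)\<bar>) \<in> O(\<lambda>n. a (n - r)))"

definition gargantuan_class :: "'a lclass \<Rightarrow> bool" where
  "gargantuan_class A \<longleftrightarrow> gargantuan (\<lambda>n. real (num_objs A n) / fact n)"

(* x n \<approx> (\<Sum>k\<ge>m. c k * f k n) *)
definition asymp_expansion ::
  "(nat \<Rightarrow> real) \<Rightarrow> nat \<Rightarrow> (nat \<Rightarrow> real) \<Rightarrow> (nat \<Rightarrow> nat \<Rightarrow> real) \<Rightarrow> bool" where
  "asymp_expansion x m c f \<longleftrightarrow>
     (\<forall>r\<ge>m. (\<lambda>n. x n - (\<Sum>k=m..r. c k * f k n)) \<in> O(\<lambda>n. f (r + 1) n)) \<and>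
     (\<forall>k\<ge>m. (\<lambda>n. f (k + 1) n) \<in> o(\<lambda>n. f k n))"

end

theory Submission
  imports Defs "HOL-Computational_Algebra.Formal_Power_Series"
begin

text \<open>Let \<open>A\<close> and \<open>B\<close> be the exponential generating functions and \<open>\<alpha>\<^sub>n\<close> the coefficients of \<open>A\<close>.
  Since the blocks are nonempty, every cyclic class of \<open>m\<close>-sequences has exactly \<open>m\<close> elements, so
  \<open>A = \<Sum>\<^sub>m B\<^sup>m / m\<close>, hence \<open>z B' = (1 - B) z A'\<close> and
  \<open>z (B\<^sup>m)' = D\<^sub>m \<cdot> z A'\<close> with \<open>D\<^sub>m = m (B\<^sup>m\<^sup>-\<^sup>1 - B\<^sup>m)\<close>.
  Extracting the \<open>n\<close>-th coefficient expresses \<open>n [z\<^sup>n] B\<^sup>m\<close> as a convolution.  Its middle part is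
  \<open>n O(\<alpha>\<^sub>n\<^sub>-\<^sub>R)\<close>, because \<open>A\<close> is gargantuan and the coefficients of \<open>B\<^sup>m\<close> are at most those of \<open>m A\<close>.
  In the upper part one inserts the expansions of order less than \<open>R\<close> of the coefficients of
  \<open>D\<^sub>m\<close>, known by induction on \<open>R\<close> simultaneously for all \<open>m\<close>; the factors \<open>k / n\<close>
  then cancel.  This replaces Bender's theorem on compositions \<open>F(A(z))\<close>.\<close>

section \<open>Power series: the differential equation and the remainder recurrence\<close>

definition pow_coeffs :: "real fps \<Rightarrow> nat \<Rightarrow> real fps" where
  "pow_coeffs B m = fps_const (real m) * (B ^ (m - 1) - B ^ m)"

lemma fps_XD_power:
  fixes A B :: "real fps"
  assumes "fps_XD B = (1 - B) * fps_XD A"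
  shows "fps_XD (B ^ m) = pow_coeffs B m * fps_XD A"
proof (cases m)
  \<comment> \<open>The truncated exponent \<open>m - 1\<close> is harmless here: the factor
    \<open>m\<close> makes \<open>pow_coeffs B 0\<close> vanish, as does the derivative of
    \<open>B ^ 0\<close>.\<close>
  case 0
  then show ?thesis by (simp add: pow_coeffs_def fps_XD_def)
next
  case (Suc k)
  have "fps_XD (B ^ m) = fps_const (real m) * B ^ k * fps_XD B"
    by (simp only: fps_XD_def o_apply fps_deriv_power Suc diff_Suc_1 mult_ac)
  also have "\<dots> = fps_const (real m) * (B ^ k - B ^ m) * fps_XD A"
    unfolding assms using Suc by (simp add: algebra_simps)
  finally show ?thesis using Suc by (simp add: pow_coeffs_def)
qed

text \<open>Apply \<open>fps_XD_power\<close> to both powers in \<open>pow_coeffs B m\<close>. The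
  coefficients of the expansion thus obey an equation of the same kind, which later makes the nested
  lower-order sums collapse.\<close>

lemma fps_XD_pow_coeffs:
  fixes A B :: "real fps"
  assumes "fps_XD B = (1 - B) * fps_XD A"
  shows "fps_XD (pow_coeffs B m) =
    fps_const (real m) * (pow_coeffs B (m - 1) - pow_coeffs B m) * fps_XD A"
proof -
  have "fps_XD (pow_coeffs B m) = fps_const (real m) * (fps_XD (B ^ (m - 1)) - fps_XD (B ^ m))"
    unfolding pow_coeffs_def by (simp add: fps_XD_def algebra_simps)
  then show ?thesis
    by (simp only: fps_XD_power[OF assms] algebra_simps)
qed

text \<open>For \<open>B = 1 - exp(-A)\<close>, \<open>pow_coeffs B m\<close> is the derivative of
  \<open>B ^ m\<close> with respect to \<open>A\<close>. The subtracted sum consists of the first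
  \<open>R\<close> main terms that this derivative predicts.\<close>

definition pow_rem :: "real fps \<Rightarrow> real fps \<Rightarrow> nat \<Rightarrow> nat \<Rightarrow> nat \<Rightarrow> real" where
  "pow_rem A B m R n =
     fps_nth (B ^ m) n - (\<Sum>k<R. fps_nth (pow_coeffs B m) k * fps_nth A (n - k))"

text \<open>The middle range is the one that a gargantuan sequence controls. Each end has only
  \<open>R\<close> terms; the upper one is reindexed by its distance \<open>j\<close> from
  \<open>n\<close>.\<close>

lemma fps_nth_mult_XD_split:
  fixes F A :: "real fps"
  assumes "1 \<le> R" "2 * R \<le> n"
  shows "fps_nth (F * fps_XD A) n =
    (\<Sum>k<R. fps_nth F k * (real (n - k) * fps_nth A (n - k)))
    + (\<Sum>k=R..n-R. fps_nth F k * (real (n - k) * fps_nth A (n - k)))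
    + (\<Sum>j<R. fps_nth F (n - j) * (real j * fps_nth A j))"
proof -
  let ?g = "\<lambda>k. fps_nth F k * (real (n - k) * fps_nth A (n - k))"
  have "fps_nth (F * fps_XD A) n = sum ?g {0..n}"
    by (simp add: fps_mult_nth)
  also have "{0..n} = ({..<R} \<union> {R..n-R}) \<union> {n-R<..n}"
    using assms by auto
  also have "sum ?g \<dots> = sum ?g {..<R} + sum ?g {R..n-R} + sum ?g {n-R<..n}"
  proof -
    have "({..<R} \<union> {R..n-R}) \<inter> {n-R<..n} = {}" "{..<R} \<inter> {R..n-R} = {}"
      using assms by auto
    then show ?thesis by (simp add: sum.union_disjoint)
  qed
  also have "sum ?g {n-R<..n} = (\<Sum>j<R. fps_nth F (n - j) * (real j * fps_nth A j))"
    using assms by (intro sum.reindex_bij_witness[of _ "\<lambda>j. n - j" "\<lambda>k. n - k"]) auto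
  finally show ?thesis .
qed

text \<open>The lower-order sums cancel because of the differential equation for
  \<^term>\<open>pow_coeffs B m\<close>; the index \<open>j = 0\<close> contributes nothing, so only remainders of
  strictly smaller order occur on the right.\<close>
lemma pow_rem_rec:
  fixes A B :: "real fps"
  assumes ode: "fps_XD B = (1 - B) * fps_XD A" and R: "1 \<le> R" "2 * R \<le> n"
  shows "real n * pow_rem A B m R n =
    (\<Sum>k=R..n-R. fps_nth (pow_coeffs B m) k * (real (n - k) * fps_nth A (n - k)))
    + (\<Sum>j\<in>{1..<R}. real j * fps_nth A j * (real m *
         (pow_rem A B (m - 1) (R - j) (n - j) - pow_rem A B m (R - j) (n - j))))"
proof -
  define \<alpha> where "\<alpha> = fps_nth A"
  define d where "d = (\<lambda>m. fps_nth (pow_coeffs B m))"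
  define e where "e = (\<lambda>i. real m * (d (m - 1) i - d m i))"
  define \<rho> where "\<rho> = (\<lambda>j. real m *
         (pow_rem A B (m - 1) (R - j) (n - j) - pow_rem A B m (R - j) (n - j)))"
  let ?mid = "\<Sum>k=R..n-R. d m k * (real (n - k) * \<alpha> (n - k))"
  have ed: "(\<Sum>i\<le>k. real i * \<alpha> i * e (k - i)) = real k * d m k" for k
  proof -
    have "real k * d m k = fps_nth (fps_XD (pow_coeffs B m)) k" by (simp add: d_def)
    also have "\<dots> = fps_nth (fps_XD A * (fps_const (real m) * (pow_coeffs B (m - 1) - pow_coeffs B m))) k"
      by (simp only: fps_XD_pow_coeffs[OF ode] mult.commute)
    also have "\<dots> = (\<Sum>i\<le>k. real i * \<alpha> i * e (k - i))"
      by (simp add: fps_mult_nth[of "fps_XD A"] atLeast0AtMost \<alpha>_def e_def d_def)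
    finally show ?thesis by simp
  qed
  \<comment> \<open>At index \<open>n - j\<close> the expansion is cut at order
    \<open>R - j\<close>, so that the total shift \<open>j + i\<close> stays below
    \<open>R\<close>.\<close>
  have dn: "d m (n - j) = \<rho> j + (\<Sum>i<R-j. e i * \<alpha> (n - j - i))" for j
    by (simp add: d_def \<rho>_def e_def \<alpha>_def pow_rem_def pow_coeffs_def right_diff_distrib
        left_diff_distrib sum_subtractf sum_distrib_left mult.assoc)
  have "real n * fps_nth (B ^ m) n = fps_nth (pow_coeffs B m * fps_XD A) n"
    by (simp flip: fps_XD_power[OF ode])
  also have "\<dots> = (\<Sum>k<R. d m k * (real (n - k) * \<alpha> (n - k))) + ?mid
      + (\<Sum>j<R. d m (n - j) * (real j * \<alpha> j))"
    unfolding fps_nth_mult_XD_split[OF R] by (simp add: d_def \<alpha>_def)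
  also have "(\<Sum>j<R. d m (n - j) * (real j * \<alpha> j)) =
      (\<Sum>j<R. real j * \<alpha> j * \<rho> j) + (\<Sum>j<R. \<Sum>i<R-j. real j * \<alpha> j * (e i * \<alpha> (n - j - i)))"
    unfolding dn by (simp add: sum.distrib algebra_simps sum_distrib_left)
  also have "(\<Sum>j<R. \<Sum>i<R-j. real j * \<alpha> j * (e i * \<alpha> (n - j - i))) =
      (\<Sum>(j, i)\<in>{(j, i). j + i < R}. real j * \<alpha> j * (e i * \<alpha> (n - j - i)))"
    by (subst sum.Sigma) (auto intro!: sum.cong)
  \<comment> \<open>Collecting terms by total shift \<open>k = j + i\<close> produces the
    convolution evaluated in \<open>ed\<close>.\<close>
  also have "\<dots> = (\<Sum>k<R. \<Sum>j\<le>k. real j * \<alpha> j * (e (k - j) * \<alpha> (n - j - (k - j))))"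
    by (rule sum.triangle_reindex)
  also have "\<dots> = (\<Sum>k<R. (\<Sum>j\<le>k. real j * \<alpha> j * e (k - j)) * \<alpha> (n - k))"
    by (auto simp: sum_distrib_right mult.assoc intro!: sum.cong)
  also have "\<dots> = (\<Sum>k<R. real k * d m k * \<alpha> (n - k))"
    by (simp only: ed)
  \<comment> \<open>Writing \<open>n - k\<close> as a difference leaves \<open>n\<close> times the
    main terms; the part with \<open>k\<close> cancels the collapsed double sum.\<close>
  also have "(\<Sum>k<R. d m k * (real (n - k) * \<alpha> (n - k))) =
      (\<Sum>k<R. real n * (d m k * \<alpha> (n - k)) - real k * d m k * \<alpha> (n - k))"
    using R by (intro sum.cong) (auto simp: of_nat_diff algebra_simps)
  also have "\<dots> = real n * (\<Sum>k<R. d m k * \<alpha> (n - k)) - (\<Sum>k<R. real k * d m k * \<alpha> (n - k))"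
    by (simp only: sum_subtractf sum_distrib_left)
  also have "(\<Sum>j<R. real j * \<alpha> j * \<rho> j) = (\<Sum>j\<in>{1..<R}. real j * \<alpha> j * \<rho> j)"
    by (rule sum.mono_neutral_right) auto
  finally show ?thesis
    unfolding pow_rem_def \<rho>_def d_def \<alpha>_def by (simp add: algebra_simps)
qed

lemma pow_rem_bigo:
  fixes A B :: "real fps"
  assumes ode: "fps_XD B = (1 - B) * fps_XD A"
    and garg: "gargantuan (fps_nth A)"
    and bound: "\<And>m k. 1 \<le> k \<Longrightarrow> \<bar>fps_nth (B ^ m) k\<bar> \<le> real m * \<bar>fps_nth A k\<bar>"
  shows "pow_rem A B m R \<in> O(\<lambda>n. fps_nth A (n - R))"
proof (induction R arbitrary: m rule: less_induct)
  case (less R)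
  define \<alpha> where "\<alpha> = fps_nth A"
  show ?case
  proof (cases "R = 0")
    case True
    \<comment> \<open>At order zero nothing is subtracted and the claim is the assumed bound. That
      bound starts at index 1, since \<open>B ^ 0\<close> has constant term 1 while its factor
      \<open>m\<close> is 0.\<close>
    show ?thesis
      using bound[of _ m] True unfolding pow_rem_def
      by (intro bigoI[where c = "real m"] eventually_mono[OF eventually_ge_at_top[of 1]]) auto
  next
    case False
    define C where "C = real m * (real (m - 1) + real m)"
    have dk: "\<bar>fps_nth (pow_coeffs B m) k\<bar> \<le> C * \<bar>\<alpha> k\<bar>" if "k \<ge> 1" for k
    proof -
      have "\<bar>fps_nth (B ^ (m - 1)) k - fps_nth (B ^ m) k\<bar> \<le> (real (m - 1) + real m) * \<bar>\<alpha> k\<bar>"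
        using bound[OF that, of "m - 1"] bound[OF that, of m]
        unfolding \<alpha>_def distrib_right by linarith
      then have "real m * \<bar>fps_nth (B ^ (m - 1)) k - fps_nth (B ^ m) k\<bar> \<le> C * \<bar>\<alpha> k\<bar>"
        unfolding C_def mult.assoc by (rule mult_left_mono) auto
      then show ?thesis by (simp add: pow_coeffs_def abs_mult)
    qed
    have C: "C \<ge> 0" by (simp add: C_def)
    let ?mid = "\<lambda>n. \<Sum>k=R..n-R. fps_nth (pow_coeffs B m) k * (real (n - k) * \<alpha> (n - k))"
    let ?low = "\<lambda>n. \<Sum>j\<in>{1..<R}. real j * \<alpha> j * (real m *
         (pow_rem A B (m - 1) (R - j) (n - j) - pow_rem A B m (R - j) (n - j)))"
    \<comment> \<open>The weight \<open>n - k\<close> is bounded crudely by \<open>n\<close>; the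
      factor \<open>n\<close> on the left of the recurrence pays for it at the end.\<close>
    have "?mid \<in> O(\<lambda>n. real n * (\<Sum>k=R..n-R. \<bar>\<alpha> k * \<alpha> (n - k)\<bar>))"
    proof (intro bigoI[where c = C] always_eventually allI)
      fix n
      have "\<bar>?mid n\<bar> \<le> (\<Sum>k=R..n-R. C * (real n * \<bar>\<alpha> k * \<alpha> (n - k)\<bar>))"
      proof (rule order.trans[OF sum_abs], rule sum_mono)
        fix k assume k: "k \<in> {R..n-R}"
        have "\<bar>fps_nth (pow_coeffs B m) k\<bar> * (real (n - k) * \<bar>\<alpha> (n - k)\<bar>)
            \<le> (C * \<bar>\<alpha> k\<bar>) * (real n * \<bar>\<alpha> (n - k)\<bar>)"
          using k False C by (intro mult_mono dk) auto
        then show "\<bar>fps_nth (pow_coeffs B m) k * (real (n - k) * \<alpha> (n - k))\<bar>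
            \<le> C * (real n * \<bar>\<alpha> k * \<alpha> (n - k)\<bar>)"
          by (simp add: abs_mult mult_ac)
      qed
      also have "\<dots> = C * (real n * (\<Sum>k=R..n-R. \<bar>\<alpha> k * \<alpha> (n - k)\<bar>))"
        by (simp add: sum_distrib_left)
      also have "\<dots> = C * norm (real n * (\<Sum>k=R..n-R. \<bar>\<alpha> k * \<alpha> (n - k)\<bar>))"
        by (simp add: abs_mult sum_nonneg)
      finally show "norm (?mid n) \<le> C * norm (real n * (\<Sum>k=R..n-R. \<bar>\<alpha> k * \<alpha> (n - k)\<bar>))"
        by simp
    qed
    also have "(\<lambda>n. real n * (\<Sum>k=R..n-R. \<bar>\<alpha> k * \<alpha> (n - k)\<bar>)) \<in> O(\<lambda>n. real n * \<alpha> (n - R))"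
      using garg False unfolding gargantuan_def \<alpha>_def
      by (intro landau_o.big.mult_left) auto
    finally have mid: "?mid \<in> O(\<lambda>n. real n * \<alpha> (n - R))" .
    \<comment> \<open>Order \<open>R - j\<close> at index \<open>n - j\<close> gives error index
      \<open>n - j - (R - j) = n - R\<close>, the same for every \<open>j\<close>.\<close>
    have shift: "(\<lambda>n. pow_rem A B m' (R - j) (n - j)) \<in> O(\<lambda>n. \<alpha> (n - R))"
      if "j \<in> {1..<R}" for j m'
    proof -
      have "pow_rem A B m' (R - j) \<in> O(\<lambda>n. \<alpha> (n - (R - j)))"
        using that unfolding \<alpha>_def by (intro less.IH) auto
      then have "(\<lambda>n. pow_rem A B m' (R - j) (n - j)) \<in> O(\<lambda>n. \<alpha> (n - j - (R - j)))"
        by (rule landau_o.big.compose) (rule filterlim_minus_const_nat_at_top)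
      then show ?thesis using that by simp
    qed
    have "?low \<in> O(\<lambda>n. \<alpha> (n - R))"
    proof (rule big_sum_in_bigo)
      fix j assume "j \<in> {1..<R}"
      then have "(\<lambda>n. (real j * \<alpha> j * real m) *
          (pow_rem A B (m - 1) (R - j) (n - j) - pow_rem A B m (R - j) (n - j)))
          \<in> O(\<lambda>n. \<alpha> (n - R))"
        using sum_in_bigo(2)[OF shift shift] by simp
      then show "(\<lambda>n. real j * \<alpha> j * (real m *
          (pow_rem A B (m - 1) (R - j) (n - j) - pow_rem A B m (R - j) (n - j))))
          \<in> O(\<lambda>n. \<alpha> (n - R))"
        by (simp only: mult.assoc)
    qed
    also have "(\<lambda>n. \<alpha> (n - R)) \<in> O(\<lambda>n. real n * \<alpha> (n - R))"
      by (intro bigoI[where c = 1] eventually_mono[OF eventually_ge_at_top[of 1]])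
        (auto simp: abs_mult mult_le_cancel_right1)
    finally have low: "?low \<in> O(\<lambda>n. real n * \<alpha> (n - R))" .
    \<comment> \<open>The recurrence holds from \<open>2 * R\<close> on, which suffices for a
      statement about eventual growth.\<close>
    have "(\<lambda>n. real n * pow_rem A B m R n) \<in> O(\<lambda>n. real n * \<alpha> (n - R)) \<longleftrightarrow>
        (\<lambda>n. ?mid n + ?low n) \<in> O(\<lambda>n. real n * \<alpha> (n - R))"
      using False unfolding \<alpha>_def
      by (intro landau_o.big.in_cong eventually_mono[OF eventually_ge_at_top[of "2 * R"]]
          pow_rem_rec ode) auto
    then have "(\<lambda>n. real n * pow_rem A B m R n) \<in> O(\<lambda>n. real n * \<alpha> (n - R))"
      using mid low by (simp add: sum_in_bigo)
    then show ?thesis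
      unfolding \<alpha>_def
      by (subst (asm) landau_o.big.mult_cancel_left)
        (auto intro!: eventually_mono[OF eventually_ge_at_top[of 1]])
  qed
qed

section \<open>Exponential generating functions and sequences of labeled blocks\<close>

definition egf :: "'a lclass \<Rightarrow> real fps" where
  "egf A = Abs_fps (\<lambda>n. real (num_objs A n) / fact n)"

lemma fps_nth_egf [simp]: "fps_nth (egf A) n = real (num_objs A n) / fact n"
  by (simp add: egf_def)

text \<open>An arbitrary label set \<open>T\<close> replaces \<open>{1..n}\<close> so that removing
  the first block stays within the family, which allows recursion on \<open>m\<close>.\<close>

definition block_lists :: "'b lclass \<Rightarrow> nat \<Rightarrow> nat set \<Rightarrow> (nat set \<times> 'b) list set" where
  "block_lists B m T = {xs. length xs = m \<and>
     (\<forall>(S, b)\<in>set xs. b \<in> objs B (card S)) \<and>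
     (\<forall>i<m. \<forall>j<m. i \<noteq> j \<longrightarrow> fst (xs ! i) \<inter> fst (xs ! j) = {}) \<and>
     (\<Union>(S, b)\<in>set xs. S) = T}"

lemma objs_labeled_power: "objs (labeled_power B m) n = block_lists B m {1..n}"
  by (simp add: labeled_power_def block_lists_def)

lemma block_lists_0: "block_lists B 0 T = (if T = {} then {[]} else {})"
  by (auto simp: block_lists_def)

lemma Cons_in_block_lists_iff:
  "(S, b) # xs \<in> block_lists B (Suc m) T \<longleftrightarrow>
     S \<subseteq> T \<and> b \<in> objs B (card S) \<and> xs \<in> block_lists B m (T - S)"
proof (cases "length xs = m")
  case True
  have "(\<forall>j<m. S \<inter> fst (xs ! j) = {}) \<longleftrightarrow> (\<forall>x\<in>set xs. S \<inter> fst x = {})"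
    using True by (simp add: all_set_conv_all_nth)
  also have "\<dots> \<longleftrightarrow> S \<inter> (\<Union>(S, b)\<in>set xs. S) = {}"
    by fastforce
  finally have *: "(\<forall>j<m. S \<inter> fst (xs ! j) = {}) \<longleftrightarrow> S \<inter> (\<Union>(S, b)\<in>set xs. S) = {}" .
  have "(\<forall>i<Suc m. \<forall>j<Suc m. i \<noteq> j \<longrightarrow> fst (((S, b) # xs) ! i) \<inter> fst (((S, b) # xs) ! j) = {})
      \<longleftrightarrow> S \<inter> (\<Union>(S, b)\<in>set xs. S) = {} \<and>
        (\<forall>i<m. \<forall>j<m. i \<noteq> j \<longrightarrow> fst (xs ! i) \<inter> fst (xs ! j) = {})"
    unfolding * [symmetric] All_less_Suc2 by (simp add: Int_commute) blast
  then show ?thesis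
    using True unfolding block_lists_def by auto
next
  case False
  then show ?thesis by (simp add: block_lists_def)
qed

lemma block_lists_Suc:
  "block_lists B (Suc m) T =
     (\<Union>S\<in>Pow T. (\<lambda>(b, xs). (S, b) # xs) ` (objs B (card S) \<times> block_lists B m (T - S)))"
    (is "?L = ?R")
proof (intro set_eqI iffI)
  fix ys assume ys: "ys \<in> ?L"
  then obtain S b xs where "ys = (S, b) # xs"
    by (cases ys) (auto simp: block_lists_def)
  then show "ys \<in> ?R" using ys by (auto simp: Cons_in_block_lists_iff)
qed (auto simp: Cons_in_block_lists_iff)

text \<open>Choose the labels of the first block, then its object, then the rest on the remaining
  labels. Grouping by block size gives a binomial convolution, which is the Cauchy product of
  exponential generating functions.\<close>

lemma card_block_lists:
  assumes fin: "\<And>k. finite (objs B k)" and "finite T"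
  shows "finite (block_lists B m T) \<and>
    real (card (block_lists B m T)) = fact (card T) * fps_nth (egf B ^ m) (card T)"
  using \<open>finite T\<close>
proof (induction m arbitrary: T)
  case 0
  then show ?case by (simp add: block_lists_0)
next
  case (Suc m)
  define n where "n = card T"
  let ?F = "\<lambda>S. (\<lambda>(b, xs). (S, b) # xs) ` (objs B (card S) \<times> block_lists B m (T - S))"
  let ?h = "\<lambda>k. real (num_objs B k) * (fact (n - k) * fps_nth (egf B ^ m) (n - k))"
  have IH: "finite (block_lists B m (T - S))"
    "real (card (block_lists B m (T - S))) =
      fact (card (T - S)) * fps_nth (egf B ^ m) (card (T - S))" for S
    using Suc by auto
  have finF: "finite (?F S)" for S
    using fin IH(1) by blast
  have cardF: "real (card (?F S)) = ?h (card S)" if "S \<in> Pow T" for S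
  proof -
    have "card (?F S) = num_objs B (card S) * card (block_lists B m (T - S))"
      by (subst card_image) (auto simp: inj_on_def num_objs_def card_cartesian_product)
    then show ?thesis
      using that Suc.prems by (simp add: IH(2) n_def card_Diff_subset finite_subset)
  qed
  have "real (card (block_lists B (Suc m) T)) = (\<Sum>S\<in>Pow T. real (card (?F S)))"
    unfolding block_lists_Suc using Suc.prems finF
    by (subst card_UN_disjoint) auto
  also have "\<dots> = (\<Sum>S\<in>Pow T. ?h (card S))"
    by (intro sum.cong refl cardF)
  also have "\<dots> = (\<Sum>k\<le>n. \<Sum>S | S \<in> Pow T \<and> card S = k. ?h (card S))"
    using Suc.prems by (intro sum.group[symmetric]) (auto simp: n_def card_mono)
  also have "\<dots> = (\<Sum>k\<le>n. real (n choose k) * ?h k)"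
    using Suc.prems by (intro sum.cong refl) (simp add: n_subsets n_def)
  also have "\<dots> = (\<Sum>k\<le>n. fact n * (fps_nth (egf B) k * fps_nth (egf B ^ m) (n - k)))"
    by (intro sum.cong refl) (simp add: binomial_fact)
  also have "\<dots> = fact n * fps_nth (egf B ^ Suc m) n"
    by (simp add: fps_mult_nth atLeast0AtMost sum_distrib_left)
  finally have "real (card (block_lists B (Suc m) T)) = fact n * fps_nth (egf B ^ Suc m) n" .
  moreover have "finite (block_lists B (Suc m) T)"
    unfolding block_lists_Suc using Suc.prems finF by auto
  ultimately show ?case by (simp add: n_def)
qed

section \<open>Rotation classes of block lists\<close>

lemma equiv_rotation: "equiv UNIV (rotation :: ('c list \<times> 'c list) set)"
proof (rule equivI)
  show "refl (rotation :: ('c list \<times> 'c list) set)"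
    unfolding refl_on_def rotation_def by (auto intro: exI[of _ 0])
  show "sym (rotation :: ('c list \<times> 'c list) set)"
  proof (rule symI)
    fix xs ys :: "'c list" assume "(xs, ys) \<in> rotation"
    then obtain k where ys: "ys = rotate k xs" by (auto simp: rotation_def)
    \<comment> \<open>The complementary rotation undoes \<open>k\<close>. Reducing \<open>k\<close>
      modulo the length first keeps the natural subtraction exact.\<close>
    have "rotate (length xs - k mod length xs) ys = xs"
    proof (cases "xs = []")
      case False
      then have "k mod length xs < length xs" by simp
      then show ?thesis
        unfolding ys by (subst rotate_conv_mod[of k]) (simp add: rotate_rotate)
    qed (simp add: ys)
    then show "(ys, xs) \<in> rotation"
      unfolding rotation_def by (auto intro: sym)
  qed
  show "trans (rotation :: ('c list \<times> 'c list) set)"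
    by (rule transI) (auto simp: rotation_def rotate_rotate)
qed auto

lemma rotate_in_block_lists:
  assumes "xs \<in> block_lists B m T"
  shows "rotate k xs \<in> block_lists B m T"
proof -
  \<comment> \<open>Rotation permutes positions injectively, so pairwise disjointness survives;
    injectivity is read off from the distinct list \<open>rotate k [0..<m]\<close>.\<close>
  have "(k + i) mod m \<noteq> (k + j) mod m" if "i < m" "j < m" "i \<noteq> j" for i j
    using nth_eq_iff_index_eq[of "rotate k [0..<m]" i j] that
    by (simp add: nth_rotate)
  then show ?thesis
    using assms unfolding block_lists_def by (auto simp: nth_rotate)
qed

text \<open>Equal entries at different positions would have label sets both equal and disjoint,
  hence empty, and there is no object of size 0.\<close>

lemma distinct_block_list:
  assumes "objs B 0 = {}" "xs \<in> block_lists B m T"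
  shows "distinct xs"
  unfolding distinct_conv_nth
proof (intro allI impI notI)
  fix i j assume ij: "i < length xs" "j < length xs" "i \<noteq> j" "xs ! i = xs ! j"
  then have "fst (xs ! i) = {}"
    using assms(2) unfolding block_lists_def by (metis (mono_tags, lifting) Int_absorb mem_Collect_eq)
  moreover have "snd (xs ! i) \<in> objs B (card (fst (xs ! i)))"
    using assms(2) nth_mem[OF ij(1)] unfolding block_lists_def by (auto split: prod.splits)
  ultimately show False using assms(1) by simp
qed

lemma card_rotation_class:
  assumes "distinct xs" "xs \<noteq> []"
  shows "card (rotation `` {xs}) = length xs"
proof -
  have "rotation `` {xs} = (\<lambda>k. rotate k xs) ` {..<length xs}"
  proof (intro set_eqI iffI)
    fix ys assume "ys \<in> rotation `` {xs}"
    then obtain k where "ys = rotate k xs" by (auto simp: rotation_def)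
    then have "ys = rotate (k mod length xs) xs" using rotate_conv_mod by metis
    then show "ys \<in> (\<lambda>k. rotate k xs) ` {..<length xs}" using assms(2) by simp
  qed (auto simp: rotation_def)
  moreover have "inj_on (\<lambda>k. rotate k xs) {..<length xs}"
  proof (rule inj_onI)
    fix i j assume ij: "i \<in> {..<length xs}" "j \<in> {..<length xs}" "rotate i xs = rotate j xs"
    then have "rotate i xs ! 0 = rotate j xs ! 0" by simp
    then have "xs ! i = xs ! j"
      using ij(1,2) assms(2) by (simp add: nth_rotate del: length_greater_0_conv)
    then show "i = j" using ij assms by (simp add: nth_eq_iff_index_eq)
  qed
  ultimately show ?thesis by (simp add: card_image)
qed

section \<open>The cycle construction and its logarithmic generating function\<close>

lemma objs_CYC_m: "objs (CYC_m m B) n = block_lists B m {1..n} // rotation"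
  by (simp add: CYC_m_def objs_labeled_power)

lemma CYC_m_objectD:
  assumes "c \<in> objs (CYC_m m B) n"
  shows "c \<noteq> {}" "c \<subseteq> block_lists B m {1..n}"
proof -
  obtain xs where xs: "xs \<in> block_lists B m {1..n}" "c = rotation `` {xs}"
    using assms unfolding objs_CYC_m by (auto elim: quotientE)
  show "c \<noteq> {}" using xs equiv_class_self[OF equiv_rotation] by auto
  show "c \<subseteq> block_lists B m {1..n}"
    using xs rotate_in_block_lists by (auto simp: rotation_def)
qed

text \<open>Any representative of the class reveals both numbers: \<open>m\<close> is its length and
  \<open>{1..n}\<close> is the union of its label sets.\<close>

lemma CYC_m_disjoint:
  assumes "c \<in> objs (CYC_m m B) n" "c \<in> objs (CYC_m m' B) n'"
  shows "m = m'" "n = n'"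
proof -
  obtain xs where "xs \<in> block_lists B m {1..n}" "xs \<in> block_lists B m' {1..n'}"
    using CYC_m_objectD[OF assms(1)] CYC_m_objectD[OF assms(2)] by blast
  then have "m = m'" "{1..n} = {1..n'}" by (simp_all add: block_lists_def)
  then show "m = m'" "n = n'"
    by (simp, metis card_atLeastAtMost diff_Suc_1)
qed

text \<open>Blocks are nonempty, so a list has no rotational symmetry and every class has exactly
  \<open>m\<close> elements. Counting lists class by class then divides by \<open>m\<close>.\<close>

lemma card_CYC_m:
  assumes fin: "\<And>k. finite (objs B k)" and empty: "objs B 0 = {}" and "m \<ge> 1"
  shows "finite (objs (CYC_m m B) n)"
    and "real (card (objs (CYC_m m B) n)) = fact n * fps_nth (egf B ^ m) n / real m"
proof -
  let ?X = "block_lists B m {1..n}"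
  have finX: "finite ?X" and cardX: "real (card ?X) = fact n * fps_nth (egf B ^ m) n"
    using card_block_lists[OF fin, of "{1..n}" m] by auto
  have Un: "\<Union> (?X // rotation) = ?X"
  proof
    show "\<Union> (?X // rotation) \<subseteq> ?X"
      using CYC_m_objectD(2) unfolding objs_CYC_m by blast
    show "?X \<subseteq> \<Union> (?X // rotation)"
      using equiv_class_self[OF equiv_rotation] by (auto simp: quotient_def)
  qed
  have "finite (\<Union> (?X // rotation))" using Un finX by simp
  then have finQ: "finite (?X // rotation)" by (rule finite_UnionD)
  then show "finite (objs (CYC_m m B) n)" by (simp add: objs_CYC_m)
  have "m * card (?X // rotation) = card (\<Union> (?X // rotation))"
  proof (rule card_partition)
    fix c assume "c \<in> ?X // rotation"
    then obtain xs where xs: "xs \<in> ?X" "c = rotation `` {xs}" by (auto elim: quotientE)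
    have "length xs = m" using xs by (simp add: block_lists_def)
    then show "card c = m"
      using xs card_rotation_class[of xs] distinct_block_list[OF empty xs(1)] \<open>m \<ge> 1\<close> by fastforce
  next
    fix c c' assume "c \<in> ?X // rotation" "c' \<in> ?X // rotation" "c \<noteq> c'"
    then show "c \<inter> c' = {}"
      using quotient_disj[OF equiv_rotation] by (metis quotientE quotientI UNIV_I)
  qed (use finQ finX Un in auto)
  then have "real m * real (card (?X // rotation)) = fact n * fps_nth (egf B ^ m) n"
    using cardX unfolding Un by (metis of_nat_mult)
  then show "real (card (objs (CYC_m m B) n)) = fact n * fps_nth (egf B ^ m) n / real m"
    using \<open>m \<ge> 1\<close> by (simp add: objs_CYC_m field_simps)
qed

lemma egf_CYC:
  assumes fin: "\<And>k. finite (objs B k)" and empty: "objs B 0 = {}"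
  shows "fps_nth (egf (CYC B)) n = (\<Sum>m=1..n. fps_nth (egf B ^ m) n / real m)"
proof -
  \<comment> \<open>\<open>B ^ m\<close> has no coefficient below index \<open>m\<close>, so the
    infinite union over \<open>m\<close> becomes finite at each size.\<close>
  have "objs (CYC_m m B) n = {}" if "m > n" for m
  proof -
    have "fps_nth (egf B ^ m) n = 0"
      using startsby_zero_power_prefix[of "egf B" m] that empty by (simp add: num_objs_def)
    then show ?thesis
      using card_CYC_m[OF fin empty, of m n] that by simp
  qed
  then have "objs (CYC B) n = (\<Union>m\<in>{1..n}. objs (CYC_m m B) n)"
    unfolding CYC_def by (auto, metis atLeastAtMost_iff empty_iff linorder_not_less One_nat_def)
  then have "card (objs (CYC B) n) = (\<Sum>m=1..n. card (objs (CYC_m m B) n))"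
    using card_CYC_m(1)[OF fin empty] CYC_m_disjoint(1)[of _ _ B n _ n]
    by (simp only:) (intro card_UN_disjoint ballI impI; fastforce)
  then show ?thesis
    using card_CYC_m(2)[OF fin empty]
    by (simp add: num_objs_def sum_divide_distrib)
qed

text \<open>This differentiates \<open>A = log (1 / (1 - B))\<close>. Coefficients are compared one
  at a time, so that a finite truncation of the logarithm suffices.\<close>

lemma fps_XD_log:
  fixes A B :: "real fps"
  assumes B0: "fps_nth B 0 = 0"
    and A: "\<And>n. fps_nth A n = (\<Sum>m=1..n. fps_nth (B ^ m) n / real m)"
  shows "fps_XD B = (1 - B) * fps_XD A"
proof (rule fps_ext)
  fix n
  define L where "L = (\<Sum>m<n. fps_const (1 / real (Suc m)) * B ^ Suc m)"
  have L: "fps_nth A k = fps_nth L k" if "k \<le> n" for k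
  proof -
    have "fps_nth A k = (\<Sum>m<k. fps_nth (B ^ Suc m) k / real (Suc m))"
      unfolding A by (simp add: sum.atLeast1_atMost_eq del: power_Suc)
    also have "\<dots> = (\<Sum>m<n. fps_nth (B ^ Suc m) k / real (Suc m))"
      using startsby_zero_power_prefix[OF B0] that
      by (intro sum.mono_neutral_left) (auto simp del: power_Suc)
    finally show ?thesis by (simp add: L_def fps_sum_nth del: power_Suc)
  qed
  have "fps_XD (fps_const (1 / real (Suc m)) * B ^ Suc m) = B ^ m * fps_XD B" for m
  proof -
    have "fps_XD (B ^ Suc m) = fps_const (real (Suc m)) * (B ^ m * fps_XD B)"
      by (simp only: fps_XD_def o_apply fps_deriv_power diff_Suc_1 mult_ac)
    then have "fps_XD (fps_const (1 / real (Suc m)) * B ^ Suc m) =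
        (fps_const (1 / real (Suc m)) * fps_const (real (Suc m))) * (B ^ m * fps_XD B)"
      by (simp only: fps_XD_mult_const mult.assoc)
    then show ?thesis by (simp only: fps_const_mult) simp
  qed
  moreover have "fps_XD (\<Sum>m<n. g m) = (\<Sum>m<n. fps_XD (g m))" for g :: "nat \<Rightarrow> real fps"
    by (simp add: fps_XD_def sum_distrib_left fps_deriv_sum)
  ultimately have XDL: "fps_XD L = (\<Sum>m<n. B ^ m) * fps_XD B"
    unfolding L_def by (simp only: sum_distrib_right)
  have "fps_nth ((1 - B) * fps_XD A) n = fps_nth ((1 - B) * fps_XD L) n"
    by (simp add: fps_mult_nth L)
  \<comment> \<open>The derivative of the truncation is a finite geometric sum, which telescopes and
    leaves an error with factor \<open>B ^ n\<close>.\<close>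
  also have "(1 - B) * fps_XD L = (1 - B ^ n) * fps_XD B"
    unfolding XDL by (simp only: one_diff_power_eq mult.assoc)
  also have "fps_nth \<dots> n = fps_nth (fps_XD B) n - fps_nth (B ^ n * fps_XD B) n"
    by (simp add: algebra_simps)
  \<comment> \<open>\<open>B ^ n\<close> starts at index \<open>n\<close>, and there its partner is
    the constant term of \<open>fps_XD B\<close>, which is 0.\<close>
  also have "fps_nth (B ^ n * fps_XD B) n = 0"
    unfolding fps_mult_nth
  proof (rule sum.neutral, rule ballI)
    fix i assume "i \<in> {0..n}"
    then show "fps_nth (B ^ n) i * fps_nth (fps_XD B) (n - i) = 0"
      using startsby_zero_power_prefix[OF B0, of n] by (cases "i = n") auto
  qed
  finally show "fps_nth (fps_XD B) n = fps_nth ((1 - B) * fps_XD A) n" by simp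
qed

section \<open>From generating functions to the probability expansion\<close>

lemma gargantuan_shift_smallo:
  assumes "gargantuan a"
  shows "(\<lambda>n. a (n - Suc k)) \<in> o(\<lambda>n. a (n - k))"
proof -
  have "(\<lambda>n. a (n - 1)) \<in> o(a)"
    using assms unfolding gargantuan_def by (intro smalloI_tendsto) auto
  then have "(\<lambda>n. a (n - k - 1)) \<in> o(\<lambda>n. a (n - k))"
    by (rule landau_o.small.compose) (rule filterlim_minus_const_nat_at_top)
  then show ?thesis by simp
qed

lemma choose_ratio_eq_egf_ratio:
  assumes "k \<le> n"
  shows "real (n choose k) * (real (num_objs A (n - k)) / real (num_objs A n)) =
    1 / fact k * (fps_nth (egf A) (n - k) / fps_nth (egf A) n)"
  using assms by (simp add: binomial_fact mult_ac)

lemma num_objs_labeled_power: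
  assumes "\<And>k. finite (objs B k)"
  shows "real (num_objs (labeled_power B m) n) = fact n * fps_nth (egf B ^ m) n"
  using card_block_lists[OF assms, of "{1..n}" m] by (simp add: num_objs_def objs_labeled_power)

lemma asymp_expansion_components:
  fixes A :: "'a lclass" and B :: "'b lclass"
  assumes A: "labeled_class A" and B: "labeled_class B"
    and B0: "num_objs B 0 = 0"
    and iso: "class_iso \<phi> A (CYC B)"
    and garg: "gargantuan_class A"
    and m: "m \<ge> 1"
  shows "asymp_expansion
    (\<lambda>n. measure_pmf.prob (pmf_of_set (objs A n)) {a. has_components B m (\<phi> a)}) 0
    (\<lambda>k. real (num_objs (labeled_power B (m - 1)) k) - real (num_objs (labeled_power B m) k))
    (\<lambda>k n. real (n choose k) * (real (num_objs A (n - k)) / real (num_objs A n)))"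
proof -
  define \<alpha> where "\<alpha> = fps_nth (egf A)"
  define f where "f = (\<lambda>k n. real (n choose k) * (real (num_objs A (n - k)) / real (num_objs A n)))"
  define c where "c = (\<lambda>k. real (num_objs (labeled_power B (m - 1)) k) - real (num_objs (labeled_power B m) k))"
  define x where "x = (\<lambda>n. measure_pmf.prob (pmf_of_set (objs A n)) {a. has_components B m (\<phi> a)})"
  have fin: "finite (objs B k)" for k
    using B by (rule labeled_class.finite_objs)
  have empty: "objs B 0 = {}"
    using B0 fin[of 0] by (simp add: num_objs_def)
  have finA: "finite (objs A n)" for n
    using A by (rule labeled_class.finite_objs)
  have bij: "bij_betw \<phi> (objs A n) (objs (CYC B) n)" for n
    using iso by (simp add: class_iso_def)
  have CYC_m_sub: "objs (CYC_m k B) n \<subseteq> objs (CYC B) n" if "k \<ge> 1" for k n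
    using that by (auto simp: CYC_def)
  have numA: "num_objs A n = num_objs (CYC B) n" for n
    unfolding num_objs_def using bij by (rule bij_betw_same_card)
  then have egfA: "egf A = egf (CYC B)"
    by (simp add: egf_def)
  have ode: "fps_XD (egf B) = (1 - egf B) * fps_XD (egf A)"
  proof (rule fps_XD_log)
    show "fps_nth (egf B) 0 = 0" by (simp add: B0)
    show "fps_nth (egf A) n = (\<Sum>m=1..n. fps_nth (egf B ^ m) n / real m)" for n
      unfolding egfA by (rule egf_CYC[OF fin empty])
  qed
  \<comment> \<open>Cycles of \<open>l\<close> blocks form part of \<open>CYC B\<close>, so their
    number, \<open>1 / l\<close> times the number of \<open>l\<close>-sequences, is at most that of
    \<open>A\<close>.\<close>
  have bound: "\<bar>fps_nth (egf B ^ l) k\<bar> \<le> real l * \<bar>fps_nth (egf A) k\<bar>" if "k \<ge> 1" for l k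
  proof (cases "l = 0")
    case True
    then show ?thesis using that by simp
  next
    case False
    have "card (objs (CYC_m l B) k) \<le> num_objs A k"
      unfolding numA unfolding num_objs_def
      using False CYC_m_sub bij_betw_finite[OF bij] finA by (intro card_mono) auto
    then have "real (card (objs (CYC_m l B) k)) \<le> real (num_objs A k)"
      by simp
    then have "fps_nth (egf B ^ l) k \<le> real l * fps_nth (egf A) k"
      using card_CYC_m(2)[OF fin empty, of l k] False by (simp add: field_simps)
    moreover have "fps_nth (egf B ^ l) k \<ge> 0"
      using num_objs_labeled_power[OF fin, of l k]
      by (metis (no_types) divide_nonneg_pos fact_gt_zero fact_nonzero nonzero_mult_div_cancel_left of_nat_0_le_iff)
    ultimately show ?thesis by simp
  qed
  have garg': "gargantuan \<alpha>"
    using garg by (simp add: gargantuan_class_def \<alpha>_def egf_def Abs_fps_inverse)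
  then have nz: "\<forall>\<^sub>F n in sequentially. \<alpha> n \<noteq> 0"
    by (simp add: gargantuan_def)
  have rem: "pow_rem (egf A) (egf B) m R \<in> O(\<lambda>n. \<alpha> (n - R))" for R
    using pow_rem_bigo[OF ode _ bound] garg' unfolding \<alpha>_def by simp
  have f_eq: "f k n = 1 / fact k * (\<alpha> (n - k) / \<alpha> n)" if "k \<le> n" for k n
    using that unfolding f_def \<alpha>_def by (rule choose_ratio_eq_egf_ratio)
  have f_cong: "\<forall>\<^sub>F n in sequentially. f k n = 1 / fact k * (\<alpha> (n - k) / \<alpha> n)" for k
    using f_eq by (intro eventually_mono[OF eventually_ge_at_top[of k]])
  \<comment> \<open>The factor \<open>m\<close> inside \<open>pow_coeffs\<close> is matched by the
    \<open>1 / m\<close> that the cycle count puts into \<open>x_eq\<close>.\<close>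
  have c_eq: "real m * c k = fact k * fps_nth (pow_coeffs (egf B) m) k" for k
    by (simp add: c_def pow_coeffs_def num_objs_labeled_power[OF fin] right_diff_distrib mult_ac)
  have x_eq: "x n = fps_nth (egf B ^ m) n / (real m * \<alpha> n)" if "\<alpha> n \<noteq> 0" for n
  proof -
    have ne: "objs A n \<noteq> {}" using that by (auto simp: \<alpha>_def num_objs_def)
    have "\<phi> ` (objs A n \<inter> {a. has_components B m (\<phi> a)}) = objs (CYC_m m B) n"
    proof (intro equalityI subsetI)
      fix c assume "c \<in> \<phi> ` (objs A n \<inter> {a. has_components B m (\<phi> a)})"
      \<comment> \<open>\<open>has_components\<close> leaves the size open;
        \<open>CYC_m_disjoint\<close> forces it to be \<open>n\<close> and the number of blocks to
        be \<open>m\<close>.\<close>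
      then obtain n' where n': "c \<in> objs (CYC B) n" "c \<in> objs (CYC_m m B) n'"
        using bij[of n] by (auto simp: has_components_def bij_betw_def)
      from n'(1) obtain m' where "c \<in> objs (CYC_m m' B) n"
        by (auto simp: CYC_def)
      then show "c \<in> objs (CYC_m m B) n"
        using n'(2) CYC_m_disjoint by metis
    next
      fix c assume c: "c \<in> objs (CYC_m m B) n"
      then have "c \<in> \<phi> ` objs A n"
        using CYC_m_sub[OF m] bij[of n] by (auto simp: bij_betw_def)
      then show "c \<in> \<phi> ` (objs A n \<inter> {a. has_components B m (\<phi> a)})"
        using c by (auto simp: has_components_def)
    qed
    moreover have "inj_on \<phi> (objs A n \<inter> {a. has_components B m (\<phi> a)})"
      using bij[of n] by (auto simp: bij_betw_def intro: inj_on_subset)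
    ultimately have "card (objs A n \<inter> {a. has_components B m (\<phi> a)}) = card (objs (CYC_m m B) n)"
      by (metis card_image)
    then show ?thesis
      using m by (simp add: x_def measure_pmf_of_set[OF ne finA] card_CYC_m(2)[OF fin empty]
          \<alpha>_def num_objs_def)
  qed
  show ?thesis
    unfolding asymp_expansion_def x_def [symmetric] c_def [symmetric] f_def [symmetric]
  proof (intro conjI allI impI)
    fix r :: nat
    \<comment> \<open>The sum up to \<open>r\<close> inclusive has \<open>r + 1\<close> terms, hence
      the remainder of order \<open>r + 1\<close>.\<close>
    have "\<forall>\<^sub>F n in sequentially. x n - (\<Sum>k=0..r. c k * f k n) =
        pow_rem (egf A) (egf B) m (r + 1) n / (real m * \<alpha> n)"
      using nz eventually_ge_at_top[of r]
    proof eventually_elim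
      case (elim n)
      have "c k * f k n = fps_nth (pow_coeffs (egf B) m) k * \<alpha> (n - k) / (real m * \<alpha> n)"
        if "k \<in> {0..r}" for k
        using that elim c_eq[of k] m by (simp add: f_eq field_simps)
      then have "(\<Sum>k=0..r. c k * f k n) =
          (\<Sum>k<r+1. fps_nth (pow_coeffs (egf B) m) k * \<alpha> (n - k)) / (real m * \<alpha> n)"
        by (simp add: sum_divide_distrib atLeast0AtMost lessThan_Suc_atMost)
      then show ?case
        by (simp only: x_eq[OF elim(1)] pow_rem_def \<alpha>_def diff_divide_distrib)
    qed
    moreover have "(\<lambda>n. pow_rem (egf A) (egf B) m (r + 1) n / (real m * \<alpha> n))
        \<in> O(\<lambda>n. f (r + 1) n)"
    proof -
      have "(\<lambda>n. pow_rem (egf A) (egf B) m (r + 1) n / \<alpha> n) \<in> O(\<lambda>n. \<alpha> (n - (r + 1)) / \<alpha> n)"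
        using rem nz by (rule landau_o.big.divide_right[rotated])
      then have "(\<lambda>n. 1 / real m * (pow_rem (egf A) (egf B) m (r + 1) n / \<alpha> n))
          \<in> O(\<lambda>n. 1 / fact (r + 1) * (\<alpha> (n - (r + 1)) / \<alpha> n))"
        using m by (subst landau_o.big.cmult, simp) (rule landau_o.big.cmult_in_iff[THEN iffD2]; simp)
      then show ?thesis
        using landau_o.big.cong[OF f_cong[of "r + 1"]] by simp
    qed
    ultimately show "(\<lambda>n. x n - (\<Sum>k=0..r. c k * f k n)) \<in> O(\<lambda>n. f (r + 1) n)"
      by (simp add: landau_o.big.in_cong)
  next
    fix k :: nat
    have "(\<lambda>n. \<alpha> (n - (k + 1)) / \<alpha> n) \<in> o(\<lambda>n. \<alpha> (n - k) / \<alpha> n)"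
      using gargantuan_shift_smallo[OF garg', of k] nz by (simp add: landau_o.small.divide_right)
    then have "(\<lambda>n. 1 / fact (k + 1) * (\<alpha> (n - (k + 1)) / \<alpha> n)) \<in> o(\<lambda>n. 1 / fact k * (\<alpha> (n - k) / \<alpha> n))"
      by (subst landau_o.small.cmult, simp) (rule landau_o.small.cmult_in_iff[THEN iffD2]; simp)
    then show "(\<lambda>n. f (k + 1) n) \<in> o(\<lambda>n. f k n)"
      using landau_o.small.cong_ex[OF f_cong f_cong] by blast
  qed
qed

theorem theorem7p1:
  fixes A :: "'a lclass" and B :: "'b lclass"
    and \<phi> :: "'a \<Rightarrow> (nat set \<times> 'b) list set"
  assumes "labeled_class A" and "labeled_class B"
    and "num_objs B 0 = 0"
    and "class_iso \<phi> A (CYC B)"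
    and "gargantuan_class A"
  shows "(\<forall>m\<ge>1. asymp_expansion
            (\<lambda>n. measure_pmf.prob (pmf_of_set (objs A n)) {a. has_components B m (\<phi> a)})
            0
            (\<lambda>k. real (num_objs (labeled_power B (m - 1)) k) - real (num_objs (labeled_power B m) k))
            (\<lambda>k n. real (n choose k) * (real (num_objs A (n - k)) / real (num_objs A n)))) \<and>
         asymp_expansion
            (\<lambda>n. measure_pmf.prob (pmf_of_set (objs A n)) {a. has_components B 1 (\<phi> a)})
            0
            (\<lambda>k. if k = 0 then 1 else - real (num_objs B k))
            (\<lambda>k n. real (n choose k) * (real (num_objs A (n - k)) / real (num_objs A n)))"
proof -
  have fin: "finite (objs B k)" for k
    using assms(2) by (rule labeled_class.finite_objs)
  \<comment> \<open>The empty sequence contributes 1 at \<open>k = 0\<close> only, where the count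
    of \<open>B\<close> vanishes; beyond it only the count of \<open>B\<close> remains.\<close>
  have "(\<lambda>k. real (num_objs (labeled_power B (1 - 1)) k) - real (num_objs (labeled_power B 1) k)) =
      (\<lambda>k. if k = 0 then 1 else - real (num_objs B k))"
    by (rule ext) (simp add: num_objs_labeled_power[OF fin] assms(3))
  then show ?thesis
    using asymp_expansion_components[OF assms] asymp_expansion_components[OF assms, of 1] by simp
qed

end
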